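(* Let $X$ be an $\infty$-pseudo-metric space and let $n\ge 0$ be an integer. Then $\mathrm{asdim}(X)\le n$ if and only if for every real number $r>0$ and every integer $m\ge 1$ there is an augmented $m\times(n+1)$-matrix $\mathcal{M}=[\mathcal{B}\,|\,\mathcal{A}]$ of subspaces of $X$ (that is, $\mathcal{B}$ is an $m\times 1$ column-matrix forming the first column of $\mathcal{M}$, and $\mathcal{A}$ is an $m\times n$-matrix forming the remaining columns), all of whose entries are of scale-$r$-dimension $0$, such that $\mathcal{M}\cdot_\cap\mathcal{M}^T\ge \mathcal{I}_X$ and $B(\mathcal{A},r)\cdot_\cap B(\mathcal{A},r)^T$ is a diagonal matrix.
   Context: An $\infty$-pseudo-metric space is a set $X$ with $d:X\times X\to[0,\infty]$ such that $d(x,x)=0$, $d(x,y)=d(y,x)$, and $d(x,y)\le d(x,z)+d(z,y)$ whenever $d(x,z),d(z,y)<\infty$. Asymptotic dimension: $\mathrm{asdim}(X)\le n$ if for every real $r>0$ there are subsets $X_0,\dots,X_n$ with $X=X_0\cup\dots\cup X_n$ such that each $X_i$ is the union of a family $\mathcal{U}_i$ of sets that is uniformly bounded (there is $S>0$ with every member of diameter at most $S$) and $r$-disjoint (points belonging to different elements of $\mathcal{U}_i$ are at distance at least $r$). Balls: for $A\subset X$ and $0<r<\infty$, $B(A,r)$ is the set of $x\in X$ with $d(x,a)<r$ for some $a\in A$. Scale-$r$-dimension $0$: for $A\subset X$, a scale-$r$-chain in $A$ is a finite sequence $x_0,\dots,x_k$ of points of $A$ such that $B(x_i,r)\cap B(x_{i+1},r)\neq\emptyset$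 for $0\le i<k$ (balls in $X$). The scale-$r$-component of $x\in A$ is the set of points of $A$ that can be joined to $x$ by a scale-$r$-chain in $A$. $A$ is of scale-$r$-dimension $0$ if the supremum of the diameters of its scale-$r$-components is finite (the diameter of $\emptyset$ is $0$). Matrices of sets: an $S\times T$-matrix of subspaces of $X$ is a function $\mathcal{A}:S\times T\to 2^X$; an $m\times n$-matrix is one indexed by $\{1,\dots,m\}\times\{1,\dots,n\}$. $\mathcal{A}^T$ is the transpose. For an $S\times T$-matrix $\mathcal{A}$ and a $T\times R$-matrix $\mathcal{C}$, $(\mathcal{A}\cdot_\cap\mathcal{C})(s,r)=\bigcup_{t\in T}\mathcal{A}(s,t)\cap\mathcal{C}(t,r)$. $B(\mathcal{A},r)$ is obtained by replacing each entry by its $r$-ball. $\mathcal{A}\le\mathcal{C}$ means entrywise inclusion. $\mathcal{I}_X$ is the square matrix with diagonal entries $X$ and all other entries $\emptyset$. A square matrix is diagonal if all its off-diagonal entries are empty. *)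

theory Defs
  imports Complex_Main "HOL-Library.Extended_Nonnegative_Real"
begin

text \<open>The space is a carrier set \<open>X\<close>, possibly empty, with a distance \<open>d\<close> whose values matter
  only on \<open>X\<close>. The finiteness guard in the triangle inequality is the usual one; for values in
  \<^typ>\<open>ennreal\<close> it is redundant.\<close>

locale inf_pseudo_metric =
  fixes X :: "'a set" and d :: "'a \<Rightarrow> 'a \<Rightarrow> ennreal"
  assumes dist_self: "x \<in> X \<Longrightarrow> d x x = 0"
    and dist_sym: "\<lbrakk>x \<in> X; y \<in> X\<rbrakk> \<Longrightarrow> d x y = d y x"
    and dist_triangle: "\<lbrakk>x \<in> X; y \<in> X; z \<in> X; d x z < \<infinity>; d z y < \<infinity>\<rbrakk>
      \<Longrightarrow> d x y \<le> d x z + d z y"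

text \<open>The supremum of the empty set in \<^typ>\<open>ennreal\<close> is \<open>0\<close>, so the empty set has diameter \<open>0\<close>.\<close>

definition diam :: "('a \<Rightarrow> 'a \<Rightarrow> ennreal) \<Rightarrow> 'a set \<Rightarrow> ennreal" where
  "diam d A = (SUP x\<in>A. SUP y\<in>A. d x y)"

definition uniformly_bounded :: "('a \<Rightarrow> 'a \<Rightarrow> ennreal) \<Rightarrow> 'a set set \<Rightarrow> bool" where
  "uniformly_bounded d \<U> \<longleftrightarrow> (\<exists>S::real. S > 0 \<and> (\<forall>U\<in>\<U>. diam d U \<le> ennreal S))"

definition r_disjoint :: "('a \<Rightarrow> 'a \<Rightarrow> ennreal) \<Rightarrow> real \<Rightarrow> 'a set set \<Rightarrow> bool" where
  "r_disjoint d r \<U> \<longleftrightarrow>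
     (\<forall>U\<in>\<U>. \<forall>V\<in>\<U>. U \<noteq> V \<longrightarrow> (\<forall>x\<in>U. \<forall>y\<in>V. ennreal r \<le> d x y))"

definition asdim_le :: "'a set \<Rightarrow> ('a \<Rightarrow> 'a \<Rightarrow> ennreal) \<Rightarrow> nat \<Rightarrow> bool" where
  "asdim_le X d n \<longleftrightarrow>
     (\<forall>r::real. r > 0 \<longrightarrow>
       (\<exists>Y :: nat \<Rightarrow> 'a set. X = (\<Union>i\<in>{0..n}. Y i) \<and>
         (\<forall>i\<in>{0..n}. \<exists>\<U>. Y i = \<Union>\<U> \<and> uniformly_bounded d \<U> \<and> r_disjoint d r \<U>)))"

definition set_ball :: "'a set \<Rightarrow> ('a \<Rightarrow> 'a \<Rightarrow> ennreal) \<Rightarrow> 'a set \<Rightarrow> real \<Rightarrow> 'a set" where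
  "set_ball X d A r = {x \<in> X. \<exists>a\<in>A. d x a < ennreal r}"

text \<open>A chain \<open>x\<^sub>0, \<dots>, x\<^sub>k\<close> is given by \<open>k\<close> and a function on \<open>nat\<close> of which only the values
  at \<open>0, \<dots>, k\<close> matter. The balls are taken in \<open>X\<close>, not in \<open>A\<close>.\<close>

definition scale_chain ::
  "'a set \<Rightarrow> ('a \<Rightarrow> 'a \<Rightarrow> ennreal) \<Rightarrow> real \<Rightarrow> 'a set \<Rightarrow> nat \<Rightarrow> (nat \<Rightarrow> 'a) \<Rightarrow> bool" where
  "scale_chain X d r A k c \<longleftrightarrow>
     (\<forall>i\<le>k. c i \<in> A) \<and>
     (\<forall>i<k. set_ball X d {c i} r \<inter> set_ball X d {c (Suc i)} r \<noteq> {})"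

definition scale_component ::
  "'a set \<Rightarrow> ('a \<Rightarrow> 'a \<Rightarrow> ennreal) \<Rightarrow> real \<Rightarrow> 'a set \<Rightarrow> 'a \<Rightarrow> 'a set" where
  "scale_component X d r A x =
     {y \<in> A. \<exists>k c. scale_chain X d r A k c \<and> c 0 = x \<and> c k = y}"

definition scale_dim_0 :: "'a set \<Rightarrow> ('a \<Rightarrow> 'a \<Rightarrow> ennreal) \<Rightarrow> real \<Rightarrow> 'a set \<Rightarrow> bool" where
  "scale_dim_0 X d r A \<longleftrightarrow>
     A \<subseteq> X \<and> (SUP x\<in>A. diam d (scale_component X d r A x)) < \<infinity>"

text \<open>Matrices of sets are functions of a row and a column index. The index sets \<open>S\<close>, \<open>T\<close> are
  passed explicitly where they are needed; values outside them are irrelevant.\<close>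

type_synonym ('s, 't, 'a) set_matrix = "'s \<Rightarrow> 't \<Rightarrow> 'a set"

definition is_set_matrix ::
  "'a set \<Rightarrow> 's set \<Rightarrow> 't set \<Rightarrow> ('s, 't, 'a) set_matrix \<Rightarrow> bool" where
  "is_set_matrix X S T A \<longleftrightarrow> (\<forall>s\<in>S. \<forall>t\<in>T. A s t \<subseteq> X)"

definition mat_transpose :: "('s, 't, 'a) set_matrix \<Rightarrow> ('t, 's, 'a) set_matrix" where
  "mat_transpose A = (\<lambda>t s. A s t)"

text \<open>The second argument is the index set over which the product is formed.\<close>

definition mat_cap_prod ::
  "('s, 't, 'a) set_matrix \<Rightarrow> 't set \<Rightarrow> ('t, 'r, 'a) set_matrix \<Rightarrow> ('s, 'r, 'a) set_matrix" where
  "mat_cap_prod A T C = (\<lambda>s r. \<Union>t\<in>T. A s t \<inter> C t r)"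

definition mat_ball ::
  "'a set \<Rightarrow> ('a \<Rightarrow> 'a \<Rightarrow> ennreal) \<Rightarrow> ('s, 't, 'a) set_matrix \<Rightarrow> real \<Rightarrow> ('s, 't, 'a) set_matrix"
  where "mat_ball X d A r = (\<lambda>s t. set_ball X d (A s t) r)"

definition mat_le ::
  "'s set \<Rightarrow> 't set \<Rightarrow> ('s, 't, 'a) set_matrix \<Rightarrow> ('s, 't, 'a) set_matrix \<Rightarrow> bool" where
  "mat_le S T A C \<longleftrightarrow> (\<forall>s\<in>S. \<forall>t\<in>T. A s t \<subseteq> C s t)"

definition mat_id :: "'a set \<Rightarrow> ('s, 's, 'a) set_matrix" where
  "mat_id X = (\<lambda>s t. if s = t then X else {})"

definition mat_diagonal :: "'s set \<Rightarrow> ('s, 's, 'a) set_matrix \<Rightarrow> bool" where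
  "mat_diagonal S A \<longleftrightarrow> (\<forall>s\<in>S. \<forall>t\<in>S. s \<noteq> t \<longrightarrow> A s t = {})"

text \<open>\<open>[B|A]\<close> for numerically indexed matrices, with indices starting at \<open>1\<close>: \<open>B\<close> is a column
  with column index \<open>1\<close>, and column \<open>j\<close> of \<open>A\<close> becomes column \<open>j + 1\<close>.\<close>

definition mat_augment ::
  "(nat, nat, 'a) set_matrix \<Rightarrow> (nat, nat, 'a) set_matrix \<Rightarrow> (nat, nat, 'a) set_matrix" where
  "mat_augment B A = (\<lambda>i j. if j = 1 then B i 1 else A i (j - 1))"

end

theory Submission imports Defs begin

text \<open>For the forward implication, let \<open>X\<close> be covered by \<open>n + 1\<close> sets that are zero-dimensional at
  a large scale, and build the matrix by induction on \<open>n\<close>. Given a matrix for the union \<open>Y\<close> of the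
  first \<open>n\<close> sets at the scale \<open>(4m + 1)s\<close>, thicken the entries of row \<open>i\<close> by \<open>2si\<close> and let the new
  entry of that row be the annulus \<open>2si \<le> dist(\<cdot>, Y) < (2i + 1)s\<close>. The annuli of different rows
  are \<open>s\<close>-separated and lie in the last set of the cover. So does what remains in row \<open>i\<close>,
  the part at distance at least \<open>(2i + 1)s\<close> from \<open>Y\<close>; as it is \<open>s\<close>-separated from the
  thickened entry of the first column, it can be added to that entry.

  Conversely, the single row of a matrix with \<open>m = 1\<close> is a cover, and the scale components of its
  entries form the required families.\<close>

section \<open>Separation and uniformly bounded disjoint families\<close>

definition separated :: "('a \<Rightarrow> 'a \<Rightarrow> ennreal) \<Rightarrow> real \<Rightarrow> 'a set \<Rightarrow> 'a set \<Rightarrow> bool" where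
  "separated d s P Q \<longleftrightarrow> (\<forall>x\<in>P. \<forall>y\<in>Q. ennreal s \<le> d x y)"

text \<open>This is the condition that \<open>asdim_le\<close> puts on each piece. It replaces
  \<open>scale_dim_0\<close> in the construction because the scale is easy to track through
  thickenings and separated unions.\<close>

definition disjoint_dim_0 :: "('a \<Rightarrow> 'a \<Rightarrow> ennreal) \<Rightarrow> real \<Rightarrow> 'a set \<Rightarrow> bool" where
  "disjoint_dim_0 d s A \<longleftrightarrow> (\<exists>\<U>. A = \<Union>\<U> \<and> uniformly_bounded d \<U> \<and> r_disjoint d s \<U>)"

text \<open>A diagonal entry of a matrix times its transpose is the union of a row, so the identity
  condition becomes a cover of \<open>W\<close> by each row. Disjointness of balls within a column
  is replaced by separation; \<open>i < i'\<close> is enough because \<open>d\<close> is symmetric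
  on \<open>X\<close>.\<close>

definition separated_columns ::
  "('a \<Rightarrow> 'a \<Rightarrow> ennreal) \<Rightarrow> 'a set \<Rightarrow> nat \<Rightarrow> nat \<Rightarrow> real \<Rightarrow>
    (nat \<Rightarrow> 'a set) \<Rightarrow> (nat \<Rightarrow> nat \<Rightarrow> 'a set) \<Rightarrow> bool"
  where "separated_columns d W m n s B A \<longleftrightarrow>
    (\<forall>i\<in>{1..m}. disjoint_dim_0 d s (B i) \<and> (\<forall>j\<in>{1..n}. disjoint_dim_0 d s (A i j)) \<and>
      W = B i \<union> (\<Union>j\<in>{1..n}. A i j)) \<and>
    (\<forall>i\<in>{1..m}. \<forall>i'\<in>{1..m}. \<forall>j\<in>{1..n}. i < i' \<longrightarrow> separated d s (A i j) (A i' j))"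

lemma diam_le_iff: "diam d A \<le> c \<longleftrightarrow> (\<forall>x\<in>A. \<forall>y\<in>A. d x y \<le> c)"
  by (simp add: diam_def SUP_le_iff)

lemma diam_mono: "A \<subseteq> B \<Longrightarrow> diam d A \<le> diam d B"
  using diam_le_iff[of d B "diam d B"] by (auto simp: diam_le_iff)

text \<open>Intersect every member with the smaller set: distinct traces come from distinct members,
  and diameters do not grow.\<close>

lemma disjoint_dim_0_subset:
  assumes "disjoint_dim_0 d R A" "A' \<subseteq> A" "s \<le> R"
  shows "disjoint_dim_0 d s A'"
proof -
  obtain \<U> S where U: "A = \<Union>\<U>" "S > 0" "\<forall>U\<in>\<U>. diam d U \<le> ennreal S" "r_disjoint d R \<U>"
    using assms(1) by (auto simp: disjoint_dim_0_def uniformly_bounded_def)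
  let ?V = "(\<lambda>U. U \<inter> A') ` \<U>"
  have "A' = \<Union>?V" using U(1) assms(2) by auto
  moreover have "uniformly_bounded d ?V"
    unfolding uniformly_bounded_def using U(2,3) by (fastforce simp: diam_le_iff)
  moreover have "ennreal s \<le> d x y"
    if "U \<in> \<U>" "V \<in> \<U>" "U \<inter> A' \<noteq> V \<inter> A'" "x \<in> U" "y \<in> V" for U V x y
  proof -
    have "ennreal R \<le> d x y" using U(4) that unfolding r_disjoint_def by blast
    then show ?thesis using ennreal_leI[OF assms(3)] order_trans by blast
  qed
  then have "r_disjoint d s ?V" unfolding r_disjoint_def by auto
  ultimately show ?thesis unfolding disjoint_dim_0_def by blast
qed

section \<open>Balls, thickenings and separated unions\<close>

context inf_pseudo_metric
begin

lemma dist_less_add: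
  assumes "x \<in> X" "y \<in> X" "z \<in> X" "d x z < ennreal a" "d z y < ennreal b"
  shows "d x y < ennreal (a + b)"
proof -
  \<comment> \<open>\<open>ennreal\<close> sends negative reals to \<open>0\<close>, so the strict
    bounds force positivity, which lets \<open>ennreal\<close> commute with the sum.\<close>
  have "a > 0" "b > 0" using assms(4,5) by (auto simp: ennreal_neg simp flip: not_le)
  have "d x y \<le> d x z + d z y"
    using assms by (intro dist_triangle) (auto intro: less_trans)
  also have "\<dots> < ennreal a + ennreal b" using assms by (simp add: add_strict_mono)
  finally show ?thesis using \<open>a > 0\<close> \<open>b > 0\<close> by simp
qed

lemma subset_set_ball: "A \<subseteq> X \<Longrightarrow> a > 0 \<Longrightarrow> A \<subseteq> set_ball X d A a"
  by (force simp: set_ball_def dist_self)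

lemma separated_sym:
  assumes "separated d s P Q" "P \<subseteq> X" "Q \<subseteq> X"
  shows "separated d s Q P"
  using assms dist_sym unfolding separated_def by (metis subsetD)

text \<open>By the path from \<open>p\<close> through \<open>x\<close> and \<open>y\<close> to
  \<open>q\<close>, thickening by \<open>a\<close> and \<open>b\<close> costs at most
  \<open>a + b\<close> of the separation.\<close>

lemma separated_set_ball:
  assumes "separated d R P Q" "P \<subseteq> X" "Q \<subseteq> X" "s + a + b \<le> R"
  shows "separated d s (set_ball X d P a) (set_ball X d Q b)"
  unfolding separated_def
proof (intro ballI, rule ccontr)
  fix x y assume xy: "x \<in> set_ball X d P a" "y \<in> set_ball X d Q b" "\<not> ennreal s \<le> d x y"
  then obtain p q where pq: "x \<in> X" "y \<in> X" "p \<in> P" "q \<in> Q" "d x p < ennreal a" "d y q < ennreal b"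
    by (auto simp: set_ball_def)
  then have X: "p \<in> X" "q \<in> X" using assms by auto
  have "d p y < ennreal (a + s)"
    by (rule dist_less_add[of _ _ x]) (use pq X xy dist_sym in auto)
  then have "d p q < ennreal (a + s + b)"
    by (rule dist_less_add[rotated 3]) (use pq X in auto)
  also have "\<dots> \<le> ennreal R" using assms(4) by (intro ennreal_leI) simp
  finally show False using assms(1) pq unfolding separated_def by (meson not_less)
qed

text \<open>A point of \<open>Q\<close> closer than \<open>s\<close> to a point of \<open>P\<close>
  would lie within \<open>a + s \<le> b\<close> of \<open>Y\<close>.\<close>

lemma separated_set_ball_compl:
  assumes "Y \<subseteq> X" "P \<subseteq> set_ball X d Y a" "Q \<subseteq> X - set_ball X d Y b" "a + s \<le> b"
  shows "separated d s P Q"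
  unfolding separated_def
proof (intro ballI, rule ccontr)
  fix x y assume xy: "x \<in> P" "y \<in> Q" "\<not> ennreal s \<le> d x y"
  then obtain p where p: "x \<in> X" "p \<in> Y" "d x p < ennreal a"
    using assms(2) by (auto simp: set_ball_def)
  have y: "y \<in> X" "p \<in> X" using xy p assms by auto
  have "d y p < ennreal (s + a)"
    by (rule dist_less_add[of _ _ x]) (use p y xy dist_sym in auto)
  also have "\<dots> \<le> ennreal b" using assms(4) by (intro ennreal_leI) simp
  finally have "y \<in> set_ball X d Y b" using y p by (auto simp: set_ball_def)
  then show False using xy assms(3) by auto
qed

lemma separated_set_balls_disjoint:
  assumes "separated d (2 * r) P Q" "P \<subseteq> X" "Q \<subseteq> X"
  shows "set_ball X d P r \<inter> set_ball X d Q r = {}"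
proof (rule ccontr)
  assume "\<not> ?thesis"
  then obtain z p q where z: "z \<in> X" "p \<in> P" "q \<in> Q" "d z p < ennreal r" "d z q < ennreal r"
    by (auto simp: set_ball_def)
  then have X: "p \<in> X" "q \<in> X" using assms by auto
  have "d p q < ennreal (r + r)"
    by (rule dist_less_add[of _ _ z]) (use z X dist_sym in auto)
  moreover have "ennreal (2 * r) \<le> d p q" using assms(1) z by (auto simp: separated_def)
  ultimately show False by simp
qed

text \<open>Replace each member by its ball: two members lose at most \<open>2 * a\<close> of their
  distance, and diameters grow by a bounded amount.\<close>

lemma disjoint_dim_0_set_ball:
  assumes "disjoint_dim_0 d R A" "A \<subseteq> X" "a > 0" "s + 2 * a \<le> R"
  shows "disjoint_dim_0 d s (set_ball X d A a)"
proof -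
  obtain \<U> S where U: "A = \<Union>\<U>" "S > 0" "\<forall>U\<in>\<U>. diam d U \<le> ennreal S" "r_disjoint d R \<U>"
    using assms(1) by (auto simp: disjoint_dim_0_def uniformly_bounded_def)
  let ?V = "(\<lambda>U. set_ball X d U a) ` \<U>"
  have sub: "U \<subseteq> X" if "U \<in> \<U>" for U using that U(1) assms(2) by auto
  have "set_ball X d A a = \<Union>?V" using U(1) by (auto simp: set_ball_def)
  \<comment> \<open>The extra \<open>1\<close> turns the weak bound \<open>S\<close> on
    \<open>d p q\<close> into a strict one, as \<open>dist_less_add\<close> requires.\<close>
  moreover have "d x y \<le> ennreal (S + 1 + 2 * a)"
    if Uxy: "U \<in> \<U>" "x \<in> set_ball X d U a" "y \<in> set_ball X d U a" for U x y
  proof -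
    obtain p q where pq: "x \<in> X" "y \<in> X" "p \<in> U" "q \<in> U" "d x p < ennreal a" "d y q < ennreal a"
      using Uxy by (auto simp: set_ball_def)
    have X: "p \<in> X" "q \<in> X" using pq sub Uxy by auto
    have "d p q \<le> ennreal S" using U(3) Uxy(1) pq by (auto simp: diam_le_iff)
    also have "\<dots> < ennreal (S + 1)" using U(2) by (simp add: ennreal_less_iff)
    finally have "d x q < ennreal (a + (S + 1))"
      using dist_less_add[of x q p] pq X by blast
    then have "d x y < ennreal (a + (S + 1) + a)"
      by (rule dist_less_add[rotated 3]) (use pq X dist_sym in auto)
    then show ?thesis by (simp add: algebra_simps)
  qed
  then have "uniformly_bounded d ?V"
    unfolding uniformly_bounded_def using U(2) assms(3)
    by (intro exI[of _ "S + 1 + 2 * a"]) (auto simp: diam_le_iff)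
  moreover have "separated d s (set_ball X d U a) (set_ball X d V a)"
    if "U \<in> \<U>" "V \<in> \<U>" "U \<noteq> V" for U V
  proof (rule separated_set_ball)
    show "separated d R U V" using U(4) that by (auto simp: separated_def r_disjoint_def)
  qed (use that sub assms(4) in auto)
  then have "r_disjoint d s ?V"
    unfolding r_disjoint_def separated_def by blast
  ultimately show ?thesis unfolding disjoint_dim_0_def by blast
qed

text \<open>The union of the two families works; pairs with one member from each are handled by the
  separation of \<open>P\<close> and \<open>Q\<close>.\<close>

lemma disjoint_dim_0_Un:
  assumes "disjoint_dim_0 d s P" "disjoint_dim_0 d s Q" "separated d s P Q" "P \<subseteq> X" "Q \<subseteq> X"
  shows "disjoint_dim_0 d s (P \<union> Q)"
proof -
  obtain \<U> S where U: "P = \<Union>\<U>" "S > 0" "\<forall>U\<in>\<U>. diam d U \<le> ennreal S" "r_disjoint d s \<U>"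
    using assms(1) by (auto simp: disjoint_dim_0_def uniformly_bounded_def)
  obtain \<V> T where V: "Q = \<Union>\<V>" "T > 0" "\<forall>U\<in>\<V>. diam d U \<le> ennreal T" "r_disjoint d s \<V>"
    using assms(2) by (auto simp: disjoint_dim_0_def uniformly_bounded_def)
  have "diam d W \<le> ennreal (S + T)" if "W \<in> \<U> \<union> \<V>" for W
  proof -
    have "ennreal S \<le> ennreal (S + T)" "ennreal T \<le> ennreal (S + T)"
      using U(2) V(2) by (auto intro!: ennreal_leI)
    then show ?thesis using that U(3) V(3) by (meson UnE order_trans)
  qed
  then have "uniformly_bounded d (\<U> \<union> \<V>)"
    unfolding uniformly_bounded_def using U(2) V(2) by (intro exI[of _ "S + T"]) auto
  moreover have "r_disjoint d s (\<U> \<union> \<V>)"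
    unfolding r_disjoint_def
  proof (intro ballI impI)
    fix E F x y
    assume EF: "E \<in> \<U> \<union> \<V>" "F \<in> \<U> \<union> \<V>" "E \<noteq> F" and xy: "x \<in> E" "y \<in> F"
    have PQ: "ennreal s \<le> d p q" "ennreal s \<le> d q p" if "p \<in> P" "q \<in> Q" for p q
      using assms(3) separated_sym[OF assms(3-5)] that by (auto simp: separated_def)
    consider "E \<in> \<U>" "F \<in> \<U>" | "E \<in> \<V>" "F \<in> \<V>" | "x \<in> P" "y \<in> Q" | "x \<in> Q" "y \<in> P"
      using EF(1,2) xy U(1) V(1) by blast
    then show "ennreal s \<le> d x y"
      using EF(3) xy U(4) V(4) PQ by cases (auto simp: r_disjoint_def)
  qed
  moreover have "P \<union> Q = \<Union>(\<U> \<union> \<V>)" using U(1) V(1) by auto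
  ultimately show ?thesis unfolding disjoint_dim_0_def by blast
qed

section \<open>Disjoint families versus scale components\<close>

text \<open>Consecutive points of a chain are closer than \<open>2 * r\<close>, so a chain never
  leaves the member in which it starts.\<close>

lemma disjoint_dim_0_imp_scale_dim_0:
  assumes "disjoint_dim_0 d (2 * r) A" "A \<subseteq> X"
  shows "scale_dim_0 X d r A"
proof -
  obtain \<U> S where U: "A = \<Union>\<U>" "\<forall>U\<in>\<U>. diam d U \<le> ennreal S" "r_disjoint d (2 * r) \<U>"
    using assms(1) by (auto simp: disjoint_dim_0_def uniformly_bounded_def)
  have "diam d (scale_component X d r A x) \<le> ennreal S" if x: "x \<in> A" for x
  proof -
    obtain U where UU: "U \<in> \<U>" "x \<in> U" using U(1) x by auto
    have "c i \<in> U" if c: "scale_chain X d r A k c" "c 0 = x" "i \<le> k" for k c i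
      using \<open>i \<le> k\<close>
    proof (induction i)
      case 0 then show ?case using c UU by simp
    next
      case (Suc i)
      then have i: "c i \<in> U" by simp
      obtain V where V: "V \<in> \<U>" "c (Suc i) \<in> V"
        using c(1) U(1) Suc.prems by (auto simp: scale_chain_def)
      have "set_ball X d {c i} r \<inter> set_ball X d {c (Suc i)} r \<noteq> {}"
        using c(1) Suc.prems by (auto simp: scale_chain_def)
      moreover have "c i \<in> X" "c (Suc i) \<in> X" using i V UU(1) U(1) assms(2) by auto
      ultimately have "\<not> separated d (2 * r) {c i} {c (Suc i)}"
        using separated_set_balls_disjoint by blast
      then have "U = V"
        using U(3) UU(1) V i unfolding r_disjoint_def separated_def by blast
      then show ?case using V by simp
    qed
    then have "scale_component X d r A x \<subseteq> U" by (auto simp: scale_component_def)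
    then show ?thesis using U(2) UU(1) diam_mono order_trans by blast
  qed
  then have "(SUP x\<in>A. diam d (scale_component X d r A x)) \<le> ennreal S"
    by (rule SUP_least)
  also have "\<dots> < \<infinity>" by simp
  finally show ?thesis using assms(2) by (simp add: scale_dim_0_def)
qed

lemma scale_dim_0_imp_disjoint_dim_0:
  assumes "scale_dim_0 X d r A" "r > 0"
  shows "disjoint_dim_0 d r A"
proof -
  have A: "A \<subseteq> X" using assms(1) by (simp add: scale_dim_0_def)
  \<comment> \<open>\<open>E\<close> is a single chain step. Components are then classes of
    \<open>E\<^sup>*\<close>, and symmetry and transitivity replace reversing and joining
    chains.\<close>
  define E where
    "E = {(x, y). x \<in> A \<and> y \<in> A \<and> set_ball X d {x} r \<inter> set_ball X d {y} r \<noteq> {}}"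
  have comp: "scale_component X d r A x = {y. (x, y) \<in> E\<^sup>*}" if "x \<in> A" for x
  proof (intro set_eqI iffI; clarsimp)
    fix y assume "y \<in> scale_component X d r A x"
    then obtain k c where c: "scale_chain X d r A k c" "c 0 = x" "c k = y"
      by (auto simp: scale_component_def)
    then have "(x, y) \<in> E ^^ k"
      unfolding relpow_fun_conv by (intro exI[of _ c]) (auto simp: scale_chain_def E_def)
    then show "(x, y) \<in> E\<^sup>*" by (rule relpow_imp_rtrancl)
  next
    fix y assume "(x, y) \<in> E\<^sup>*"
    then obtain k where "(x, y) \<in> E ^^ k" by (auto dest: rtrancl_imp_relpow)
    then obtain c where c: "c 0 = x" "c k = y" "\<forall>i<k. (c i, c (Suc i)) \<in> E"
      by (auto simp: relpow_fun_conv)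
    \<comment> \<open>A path of length \<open>0\<close> has no edge, so for \<open>i = 0\<close>
      membership comes from \<open>x \<in> A\<close>.\<close>
    have "c i \<in> A" if "i \<le> k" for i
      using that c \<open>x \<in> A\<close> by (cases i) (auto simp: E_def)
    then show "y \<in> scale_component X d r A x"
      using c by (auto simp: scale_component_def scale_chain_def E_def)
  qed
  have symE: "sym (E\<^sup>*)" by (rule sym_rtrancl) (auto simp: sym_def E_def)
  let ?U = "scale_component X d r A ` A"
  have "A = \<Union>?U" using comp by (fastforce simp: scale_component_def)
  moreover have "uniformly_bounded d ?U"
  proof -
    let ?s = "SUP x\<in>A. diam d (scale_component X d r A x)"
    have fin: "?s < \<infinity>" using assms(1) by (simp add: scale_dim_0_def)
    \<comment> \<open>The summand \<open>1\<close> keeps the bound positive when the supremum is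
      \<open>0\<close>.\<close>
    have "diam d (scale_component X d r A x) \<le> ennreal (enn2real ?s + 1)" if "x \<in> A" for x
    proof -
      have "diam d (scale_component X d r A x) \<le> ?s" using that by (rule SUP_upper)
      also have "\<dots> = ennreal (enn2real ?s)" using fin by (simp add: less_top)
      also have "\<dots> \<le> ennreal (enn2real ?s + 1)" by (intro ennreal_leI) simp
      finally show ?thesis .
    qed
    then show ?thesis unfolding uniformly_bounded_def
      by (intro exI[of _ "enn2real ?s + 1"]) (auto intro: add_nonneg_pos)
  qed
  moreover have "scale_component X d r A p = scale_component X d r A q"
    if pq: "p \<in> A" "q \<in> A" "x \<in> scale_component X d r A p" "y \<in> scale_component X d r A q"
      and xy: "\<not> ennreal r \<le> d x y" for p q x y
  proof -
    have xyA: "x \<in> A" "y \<in> A" using pq by (auto simp: scale_component_def)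
    then have "x \<in> X" "y \<in> X" using A by auto
    \<comment> \<open>Points closer than \<open>r\<close> are joined by one step, since
      \<open>y\<close> lies in both balls.\<close>
    then have "y \<in> set_ball X d {x} r \<inter> set_ball X d {y} r"
      using xy \<open>r > 0\<close> dist_sym[of y x] by (auto simp: set_ball_def dist_self)
    then have "(x, y) \<in> E" using xyA by (auto simp: E_def)
    moreover have "(p, x) \<in> E\<^sup>*" "(q, y) \<in> E\<^sup>*" using pq comp by auto
    ultimately have "(p, q) \<in> E\<^sup>*" using symE by (meson rtrancl.rtrancl_into_rtrancl rtrancl_trans symD)
    then show ?thesis using comp pq symE by (auto dest: symD intro: rtrancl_trans)
  qed
  then have "r_disjoint d r ?U" unfolding r_disjoint_def by blast
  ultimately show ?thesis unfolding disjoint_dim_0_def by blast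
qed

section \<open>Construction of the matrix from annuli\<close>

text \<open>Each new column costs a factor \<open>4 * real m + 1\<close> of the scale, hence the
  power. The scale \<open>s\<close> varies in the induction because the hypothesis is applied at
  \<open>R\<close>.\<close>

lemma exists_separated_columns:
  assumes "s > 0"
    and "\<forall>i\<le>n. Y i \<subseteq> X \<and> disjoint_dim_0 d (s * (4 * real m + 1) ^ n) (Y i)"
  shows "\<exists>B A. separated_columns d (\<Union>i\<le>n. Y i) m n s B A"
  using assms
proof (induction n arbitrary: s)
  case 0
  then show ?case
    by (intro exI[of _ "\<lambda>_. Y 0"] exI[of _ "\<lambda>_ _. {}"]) (auto simp: separated_columns_def)
next
  case (Suc n)
  define R where "R = s * (4 * real m + 1)"
  define V where "V = (\<Union>i\<le>n. Y i)"
  define W where "W = V \<union> Y (Suc n)"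
  have "s > 0" "R > 0" using Suc.prems(1) by (auto simp: R_def intro!: mult_pos_pos add_nonneg_pos)
  have VX: "V \<subseteq> X" using Suc.prems(2) unfolding V_def by (intro UN_least) simp
  have WX: "W \<subseteq> X" using VX Suc.prems(2) by (simp add: W_def)
  have R_pow: "s * (4 * real m + 1) ^ Suc n = R * (4 * real m + 1) ^ n" by (simp add: R_def)
  have "\<forall>i\<le>n. Y i \<subseteq> X \<and> disjoint_dim_0 d (R * (4 * real m + 1) ^ n) (Y i)"
    using Suc.prems(2) unfolding R_pow by simp
  from Suc.IH[OF \<open>R > 0\<close> this, folded V_def]
  obtain B A where cols: "separated_columns d V m n R B A" by blast
  have B: "\<And>i. i \<in> {1..m} \<Longrightarrow> disjoint_dim_0 d R (B i)"
    and A: "\<And>i j. i \<in> {1..m} \<Longrightarrow> j \<in> {1..n} \<Longrightarrow> disjoint_dim_0 d R (A i j)"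
    and cov: "\<And>i. i \<in> {1..m} \<Longrightarrow> V = B i \<union> (\<Union>j\<in>{1..n}. A i j)"
    and sepA: "\<And>i i' j. i \<in> {1..m} \<Longrightarrow> i' \<in> {1..m} \<Longrightarrow> j \<in> {1..n} \<Longrightarrow> i < i' \<Longrightarrow>
      separated d R (A i j) (A i' j)"
    using cols by (simp_all add: separated_columns_def)
  \<comment> \<open>Radii grow by \<open>2 * s\<close> per row: one \<open>s\<close> is the width of
    the annulus, the other the gap before the annulus of the next row.\<close>
  define a where "a i = 2 * s * real i" for i
  define N where "N P i = W \<inter> set_ball X d P (a i)" for P i
  define F where "F i = W - set_ball X d V (a i + s)" for i
  define C where "C i = W \<inter> set_ball X d V (a i + s) - set_ball X d V (a i)" for i
  define B' where "B' i = N (B i) i \<union> F i" for i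
  define A' where "A' i j = (if j = Suc n then C i else N (A i j) i)" for i j
  \<comment> \<open>Rows are numbered from \<open>1\<close>; at radius \<open>0\<close> a ball would
    be empty and miss \<open>V\<close>.\<close>
  have apos: "a i > 0" if "i \<in> {1..m}" for i using that \<open>s > 0\<close> by (simp add: a_def)
  \<comment> \<open>Both radii are at most \<open>2 * s * real m\<close>, so \<open>R\<close> pays
    for two thickenings and still leaves \<open>s\<close>. The case \<open>i = i'\<close> treats two
    members of one entry.\<close>
  have aR: "s + a i + a i' \<le> R" if "i \<in> {1..m}" "i' \<in> {1..m}" for i i'
  proof -
    have "s * (2 * real i + 2 * real i' + 1) \<le> s * (4 * real m + 1)"
      using that \<open>s > 0\<close> by (intro mult_left_mono) auto
    then show ?thesis by (simp add: a_def R_def algebra_simps)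
  qed
  have step: "a i + s + s \<le> a i'" if "i < i'" for i i'
  proof -
    have "s * (2 * real i + 2) \<le> s * (2 * real i')"
      using that \<open>s > 0\<close> by (intro mult_left_mono) auto
    then show ?thesis by (simp add: a_def algebra_simps)
  qed
  have last: "disjoint_dim_0 d s P" if "P \<subseteq> Y (Suc n)" for P
  proof (rule disjoint_dim_0_subset[OF _ that])
    show "disjoint_dim_0 d (s * (4 * real m + 1) ^ Suc n) (Y (Suc n))"
      using Suc.prems(2) by blast
    have "1 \<le> (4 * real m + 1) ^ Suc n" by (rule one_le_power) simp
    then show "s \<le> s * (4 * real m + 1) ^ Suc n" using \<open>s > 0\<close> by simp
  qed
  have N_dim: "disjoint_dim_0 d s (N P i)"
    if "i \<in> {1..m}" "disjoint_dim_0 d R P" "P \<subseteq> V" for P i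
  proof (rule disjoint_dim_0_subset[of d s])
    show "disjoint_dim_0 d s (set_ball X d P (a i))"
      using that VX apos aR[of i i] by (intro disjoint_dim_0_set_ball[of R]) auto
  qed (auto simp: N_def)
  \<comment> \<open>Removing either ball from \<open>W\<close> leaves only points of
    \<open>Y (Suc n)\<close>, so \<open>last\<close> applies to \<open>F i\<close> and
    \<open>C i\<close>.\<close>
  have V_near: "V \<subseteq> set_ball X d V (a i)" "V \<subseteq> set_ball X d V (a i + s)" if "i \<in> {1..m}" for i
    using subset_set_ball[OF VX] apos[OF that] \<open>s > 0\<close> by auto
  have B'_dim: "disjoint_dim_0 d s (B' i)" if i: "i \<in> {1..m}" for i
    unfolding B'_def
  proof (rule disjoint_dim_0_Un)
    have BV: "B i \<subseteq> V" using cov[OF i] by auto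
    then show "disjoint_dim_0 d s (N (B i) i)" using N_dim i B by blast
    show "disjoint_dim_0 d s (F i)"
      using V_near[OF i] by (intro last) (auto simp: F_def W_def)
    show "separated d s (N (B i) i) (F i)"
      by (rule separated_set_ball_compl[OF VX, of _ "a i" _ "a i + s"])
        (use BV WX in \<open>auto simp: N_def F_def set_ball_def\<close>)
  qed (use WX in \<open>auto simp: N_def F_def\<close>)
  have A'_dim: "disjoint_dim_0 d s (A' i j)" if i: "i \<in> {1..m}" and j: "j \<in> {1..Suc n}" for i j
  proof (cases "j = Suc n")
    case True
    have "C i \<subseteq> Y (Suc n)" using V_near[OF i] by (auto simp: C_def W_def)
    then show ?thesis using True last by (simp add: A'_def)
  next
    case False
    then have "j \<in> {1..n}" using j by auto
    then have "disjoint_dim_0 d s (N (A i j) i)"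
      using i A cov[OF i] by (intro N_dim) auto
    then show ?thesis using False by (simp add: A'_def)
  qed
  have cov': "W = B' i \<union> (\<Union>j\<in>{1..Suc n}. A' i j)" if i: "i \<in> {1..m}" for i
  proof -
    have "(\<Union>j\<in>{1..Suc n}. A' i j) = C i \<union> (\<Union>j\<in>{1..n}. N (A i j) i)"
      by (auto simp: A'_def atLeastAtMostSuc_conv)
    \<comment> \<open>Balls commute with unions, so the thickened row covers the part of
      \<open>W\<close> near \<open>V\<close>.\<close>
    moreover have "N V i = N (B i) i \<union> (\<Union>j\<in>{1..n}. N (A i j) i)"
      by (subst cov[OF i]) (auto simp: N_def set_ball_def)
    moreover have "W = N V i \<union> C i \<union> F i" by (auto simp: N_def C_def F_def)
    ultimately show ?thesis by (auto simp: B'_def)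
  qed
  have sep': "separated d s (A' i j) (A' i' j)"
    if i: "i \<in> {1..m}" "i' \<in> {1..m}" "i < i'" and j: "j \<in> {1..Suc n}" for i i' j
  proof (cases "j = Suc n")
    case True
    \<comment> \<open>\<open>C i\<close> is within \<open>a i + s\<close> of \<open>V\<close>, while
      \<open>C i'\<close> avoids the ball of radius \<open>a i'\<close>, which is at least
      \<open>a i + 2 * s\<close>.\<close>
    have "separated d s (C i) (C i')"
      by (rule separated_set_ball_compl[OF VX, of _ "a i + s" _ "a i'"])
        (use WX step[OF i(3)] in \<open>auto simp: C_def\<close>)
    then show ?thesis using True by (simp add: A'_def)
  next
    case False
    then have j': "j \<in> {1..n}" using j by auto
    then have "A i j \<subseteq> V" "A i' j \<subseteq> V" using cov[OF i(1)] cov[OF i(2)] by blast+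
    then have "separated d s (set_ball X d (A i j) (a i)) (set_ball X d (A i' j) (a i'))"
      using sepA i j' aR VX by (intro separated_set_ball[of R]) auto
    then show ?thesis using False by (auto simp: A'_def N_def separated_def)
  qed
  have "(\<Union>i\<le>Suc n. Y i) = W" by (auto simp: W_def V_def atMost_Suc)
  moreover have "separated_columns d W m (Suc n) s B' A'"
    unfolding separated_columns_def using B'_dim A'_dim cov' sep' by blast
  ultimately show ?case by auto
qed

end

section \<open>Translation between covers and matrices\<close>

theorem theorem4p2:
  fixes X :: "'a set" and d :: "'a \<Rightarrow> 'a \<Rightarrow> ennreal" and n :: nat
  assumes "inf_pseudo_metric X d"
  shows "asdim_le X d n \<longleftrightarrow>
    (\<forall>r::real. \<forall>m::nat. r > 0 \<longrightarrow> m \<ge> 1 \<longrightarrow>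
      (\<exists>(B :: (nat, nat, 'a) set_matrix) (A :: (nat, nat, 'a) set_matrix) M.
         is_set_matrix X {1..m} {1..1} B \<and>
         is_set_matrix X {1..m} {1..n} A \<and>
         M = mat_augment B A \<and>
         (\<forall>i\<in>{1..m}. \<forall>j\<in>{1..n+1}. scale_dim_0 X d r (M i j)) \<and>
         mat_le {1..m} {1..m} (mat_id X) (mat_cap_prod M {1..n+1} (mat_transpose M)) \<and>
         mat_diagonal {1..m}
           (mat_cap_prod (mat_ball X d A r) {1..n} (mat_transpose (mat_ball X d A r)))))"
  (is "_ \<longleftrightarrow> (\<forall>r m. r > 0 \<longrightarrow> m \<ge> 1 \<longrightarrow> ?P r m)")
proof -
  interpret inf_pseudo_metric X d by fact
  show ?thesis
  proof (intro iffI allI impI)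
    fix r :: real and m :: nat
    assume asdim: "asdim_le X d n" and "r > 0" "m \<ge> 1"
    \<comment> \<open>Points whose \<open>r\<close>-balls meet are closer than \<open>2 * r\<close>;
      this scale thus yields both scale-\<open>r\<close>-dimension \<open>0\<close> and disjoint
      balls.\<close>
    define s where "s = 2 * r"
    have "s > 0" using \<open>r > 0\<close> by (simp add: s_def)
    then have "s * (4 * real m + 1) ^ n > 0" by (auto intro!: mult_pos_pos zero_less_power add_nonneg_pos)
    then obtain Y where Y: "X = (\<Union>i\<in>{0..n}. Y i)"
      "\<forall>i\<in>{0..n}. disjoint_dim_0 d (s * (4 * real m + 1) ^ n) (Y i)"
      using asdim unfolding asdim_le_def disjoint_dim_0_def by blast
    have XY: "(\<Union>i\<le>n. Y i) = X" using Y(1) by (auto simp: atMost_atLeast0)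
    have "\<forall>i\<le>n. Y i \<subseteq> X \<and> disjoint_dim_0 d (s * (4 * real m + 1) ^ n) (Y i)"
      using Y(2) XY by auto
    from exists_separated_columns[OF \<open>s > 0\<close> this, unfolded XY] 
    obtain B A where cols: "separated_columns d X m n s B A" by blast
    have B: "\<And>i. i \<in> {1..m} \<Longrightarrow> disjoint_dim_0 d s (B i)"
      and A: "\<And>i j. i \<in> {1..m} \<Longrightarrow> j \<in> {1..n} \<Longrightarrow> disjoint_dim_0 d s (A i j)"
      and cov: "\<And>i. i \<in> {1..m} \<Longrightarrow> X = B i \<union> (\<Union>j\<in>{1..n}. A i j)"
      and sep: "\<And>i i' j. i \<in> {1..m} \<Longrightarrow> i' \<in> {1..m} \<Longrightarrow> j \<in> {1..n} \<Longrightarrow> i < i' \<Longrightarrow>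
        separated d s (A i j) (A i' j)"
      using cols by (simp_all add: separated_columns_def)
    have BX: "B i \<subseteq> X" and AX: "j \<in> {1..n} \<Longrightarrow> A i j \<subseteq> X" if "i \<in> {1..m}" for i j
      using cov[OF that] by auto
    define M where "M = mat_augment (\<lambda>i _. B i) A"
    have M: "M i j = (if j = 1 then B i else A i (j - 1))" for i j
      by (simp add: M_def mat_augment_def)
    have dim: "scale_dim_0 X d r (M i j)" if i: "i \<in> {1..m}" and j: "j \<in> {1..n+1}" for i j
    proof (cases "j = 1")
      case True
      then show ?thesis
        using B[OF i] BX[OF i] by (auto simp: M s_def intro: disjoint_dim_0_imp_scale_dim_0)
    next
      case False
      then have "j - 1 \<in> {1..n}" using j by auto
      then show ?thesis
        using False A[OF i] AX[OF i] by (auto simp: M s_def intro!: disjoint_dim_0_imp_scale_dim_0)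
    qed
    have row: "X \<subseteq> (\<Union>j\<in>{1..n+1}. M i j)" if i: "i \<in> {1..m}" for i
    proof -
      have "B i = M i 1" "\<And>j. j \<in> {1..n} \<Longrightarrow> A i j = M i (j + 1)" by (auto simp: M)
      then show ?thesis by (subst cov[OF i]) fastforce
    qed
    have disj: "set_ball X d (A i j) r \<inter> set_ball X d (A i' j) r = {}"
      if i: "i \<in> {1..m}" "i' \<in> {1..m}" "i \<noteq> i'" and j: "j \<in> {1..n}" for i i' j
    proof -
      \<comment> \<open>Separation is known for the smaller row index first; symmetry gives the
        other order.\<close>
      have "separated d s (A i j) (A i' j)"
        using i j sep AX separated_sym by (metis linorder_neqE_nat)
      then show ?thesis using i j AX by (auto simp: s_def dest: separated_set_balls_disjoint)
    qed
    show "?P r m"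
    proof (intro exI conjI)
      show "is_set_matrix X {1..m} {1..1} (\<lambda>i _. B i)" "is_set_matrix X {1..m} {1..n} A"
        using BX AX by (auto simp: is_set_matrix_def)
      show "M = mat_augment (\<lambda>i _. B i) A" by (fact M_def)
      show "\<forall>i\<in>{1..m}. \<forall>j\<in>{1..n+1}. scale_dim_0 X d r (M i j)" using dim by blast
      show "mat_le {1..m} {1..m} (mat_id X) (mat_cap_prod M {1..n+1} (mat_transpose M))"
        using row by (auto simp: mat_le_def mat_id_def mat_cap_prod_def mat_transpose_def)
      show "mat_diagonal {1..m}
           (mat_cap_prod (mat_ball X d A r) {1..n} (mat_transpose (mat_ball X d A r)))"
        using disj
        by (simp add: mat_diagonal_def mat_cap_prod_def mat_transpose_def mat_ball_def)
    qed
  next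
    assume "\<forall>r m. r > 0 \<longrightarrow> m \<ge> 1 \<longrightarrow> ?P r m"
    then have P: "?P r 1" if "r > 0" for r using that by blast
    show "asdim_le X d n"
      unfolding asdim_le_def disjoint_dim_0_def[symmetric]
    proof (intro allI impI)
      fix r :: real assume "r > 0"
      from P[OF this] obtain M :: "(nat, nat, 'a) set_matrix" where
        dim: "\<forall>j\<in>{1..n+1}. scale_dim_0 X d r (M 1 j)"
        and le: "mat_le {1..1} {1..1} (mat_id X) (mat_cap_prod M {1..n+1} (mat_transpose M))"
        by auto
      \<comment> \<open>The only entry of the product is the union of the single row.\<close>
      have "X \<subseteq> (\<Union>j\<in>{1..n+1}. M 1 j)"
        using le by (auto simp: mat_le_def mat_id_def mat_cap_prod_def mat_transpose_def)
      moreover have "M 1 j \<subseteq> X" if "j \<in> {1..n+1}" for j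
        using dim that by (auto simp: scale_dim_0_def)
      ultimately have "X = (\<Union>j\<in>{1..n+1}. M 1 j)" by blast
      \<comment> \<open>Columns are numbered from \<open>1\<close>, the sets in
        \<open>asdim_le\<close> from \<open>0\<close>.\<close>
      also have "{1..n+1} = Suc ` {0..n}" by (simp add: image_Suc_atLeastAtMost)
      finally have "X = (\<Union>i\<in>{0..n}. M 1 (Suc i))" by (simp only: image_image)
      moreover have "\<forall>i\<in>{0..n}. disjoint_dim_0 d r (M 1 (Suc i))"
        using dim \<open>r > 0\<close> by (auto intro: scale_dim_0_imp_disjoint_dim_0)
      ultimately show "\<exists>Y. X = (\<Union>i\<in>{0..n}. Y i) \<and> (\<forall>i\<in>{0..n}. disjoint_dim_0 d r (Y i))"
        by blast
    qed
  qed
qed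

end
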